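(* Let $F$ be any one of the faces $(U_{2,3}^{123},U_{1,2}^{12})$, $(\mathcal W_2^{34},U_{1,2}^{12})$, $(\mathcal W_2^{14},U_{1,3}^{124})$ of $\Gamma_4$. For real $a,b\ge 0$, the point $\mathbf h=(a,b)\in F$ is entropic if and only if $a+b\ge \log\lceil 2^a\rceil$.
   Context: $N_4=\{1,2,3,4\}$. $\Gamma_4$ is the cone of all polymatroid rank functions on $N_4$. A set function $\mathbf h:2^{N_4}\to\mathbb R$ is called entropic if there is a random vector $(X_1,X_2,X_3,X_4)$, each $X_i$ taking values in a finite set, with $\mathbf h(A)=H(X_A)$ for all $A\subseteq N_4$, where $H$ is Shannon entropy, $X_A=(X_j,j\in A)$ and $\mathbf h(\emptyset)=0$. Logarithms (also in the entropy) are to base $2$. For two (poly)matroids $M_1,M_2$ on $N_4$ with rank functions $\mathbf r_1,\mathbf r_2$, $(M_1,M_2)$ denotes the face $\{a\mathbf r_1+b\mathbf r_2:a,b\ge0\}$ of $\Gamma_4$, and $(a,b)$ denotes the point $a\mathbf r_1+b\mathbf r_2$. For $\alpha\subseteq N_4$ with $|\alpha|=m$, $U^\alpha_{k,m}$ is the matroid on $N_4$ with rank function $\mathbf r(A)=\min\{k,|A\cap\alpha|\}$. For $|\alpha|=2$, $\mathcal W_2^\alpha$ is the matroid on $N_4$ with $\mathbf r(\emptyset)=0$, $\mathbf r(A)=1$ if $|A|=1$ or $A=\alpha$, and $\mathbf r(A)=2$ otherwise. Superscripts such as $123$ abbreviate $\{1,2,3\}$. *)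

theory Defs
  imports "HOL-Probability.Probability"
begin

definition N4 :: "nat set" where
  "N4 = {1, 2, 3, 4}"

text \<open>Set functions on \<open>N4\<close> are represented as functions \<open>nat set \<Rightarrow> real\<close>; only their values on
  subsets of \<open>N4\<close> are meaningful.\<close>

definition Gamma4 :: "(nat set \<Rightarrow> real) set" where
  "Gamma4 = {h. h {} = 0
     \<and> (\<forall>A B. A \<subseteq> B \<and> B \<subseteq> N4 \<longrightarrow> h A \<le> h B)
     \<and> (\<forall>A B. A \<subseteq> N4 \<and> B \<subseteq> N4 \<longrightarrow> h (A \<inter> B) + h (A \<union> B) \<le> h A + h B)}"

definition uniform_rank :: "nat \<Rightarrow> nat set \<Rightarrow> nat set \<Rightarrow> real" where
  "uniform_rank k \<alpha> A = real (min k (card (A \<inter> \<alpha>)))"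

definition W2_rank :: "nat set \<Rightarrow> nat set \<Rightarrow> real" where
  "W2_rank \<alpha> A = (if A = {} then 0 else if card A = 1 \<or> A = \<alpha> then 1 else 2)"

definition face_point ::
    "(nat set \<Rightarrow> real) \<Rightarrow> (nat set \<Rightarrow> real) \<Rightarrow> real \<Rightarrow> real \<Rightarrow> nat set \<Rightarrow> real" where
  "face_point r\<^sub>1 r\<^sub>2 a b = (\<lambda>A. a * r\<^sub>1 A + b * r\<^sub>2 A)"

definition face :: "(nat set \<Rightarrow> real) \<Rightarrow> (nat set \<Rightarrow> real) \<Rightarrow> (nat set \<Rightarrow> real) set" where
  "face r\<^sub>1 r\<^sub>2 = {h. \<exists>a\<ge>0. \<exists>b\<ge>0. \<forall>A\<subseteq>N4. h A = face_point r\<^sub>1 r\<^sub>2 a b A}"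

definition is_face_of_Gamma4 :: "(nat set \<Rightarrow> real) set \<Rightarrow> bool" where
  "is_face_of_Gamma4 F \<longleftrightarrow> F \<subseteq> Gamma4 \<and>
     (\<forall>g\<in>Gamma4. \<forall>h\<in>Gamma4. (\<lambda>A. g A + h A) \<in> F \<longrightarrow> g \<in> F \<and> h \<in> F)"

definition subvector :: "(nat \<Rightarrow> 'a \<Rightarrow> nat) \<Rightarrow> nat set \<Rightarrow> 'a \<Rightarrow> nat \<Rightarrow> nat" where
  "subvector X A \<omega> = (\<lambda>i\<in>A. X i \<omega>)"

definition joint_entropy :: "'a measure \<Rightarrow> (nat \<Rightarrow> 'a \<Rightarrow> nat) \<Rightarrow> nat set \<Rightarrow> real" where
  "joint_entropy M X A =
     prob_space.entropy M 2 (count_space (subvector X A ` space M)) (subvector X A)"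

text \<open>The finite alphabets are labelled by natural numbers, and \<open>simple_function\<close> says that \<open>X i\<close> is
  a random variable with finitely many values.  HOL cannot quantify over the type of the sample
  space, so one that accommodates every finite joint distribution is fixed; the lemma
  \<open>entropicI\<close> below shows that this is no restriction.\<close>

definition entropic :: "(nat set \<Rightarrow> real) \<Rightarrow> bool" where
  "entropic h \<longleftrightarrow>
     (\<exists>(M :: (nat \<Rightarrow> nat) measure) X. prob_space M \<and> (\<forall>i\<in>N4. simple_function M (X i)) \<and>
        (\<forall>A\<subseteq>N4. h A = joint_entropy M X A))"

lemma entropicI:
  fixes M :: "'a measure"
  assumes "prob_space M" and X: "\<forall>i\<in>N4. simple_function M (X i)"
    and h: "\<forall>A\<subseteq>N4. h A = joint_entropy M X A"
  shows "entropic h"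
proof -
  interpret prob_space M by fact
  define f where "f = subvector X N4"
  have sub: "subvector X A \<omega> = restrict (f \<omega>) A" if "A \<subseteq> N4" for A \<omega>
    using that by (auto simp: f_def subvector_def restrict_def fun_eq_iff)
  have simple: "simple_function M (subvector X A)" if "A \<subseteq> N4" for A
  proof -
    have "finite A" using that by (rule finite_subset) (simp add: N4_def)
    then show ?thesis using that
    proof (induction A)
      case empty
      then show ?case by (simp add: subvector_def)
    next
      case (insert i A)
      have "simple_function M (\<lambda>\<omega>. (subvector X A \<omega>)(i := X i \<omega>))"
        using insert X by (intro simple_function_compose2[where h = "\<lambda>g y. g(i := y)"]) auto
      moreover have "(\<lambda>\<omega>. (subvector X A \<omega>)(i := X i \<omega>)) = subvector X (insert i A)"
        using insert by (auto simp: subvector_def fun_eq_iff)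
      ultimately show ?case by simp
    qed
  qed
  define M' where "M' = distr M (count_space (f ` space M)) f"
  have f: "f \<in> M \<rightarrow>\<^sub>M count_space (f ` space M)"
    using simple[of N4] by (auto simp: f_def simple_function_def measurable_count_space_eq2)
  have M': "prob_space M'" unfolding M'_def using f by (rule prob_space_distr)
  have space: "space M' = f ` space M" by (simp add: M'_def)
  have "finite (f ` space M)" using simple[of N4] by (simp add: f_def simple_function_def)
  then have "simple_function M' g" for g :: "(nat \<Rightarrow> nat) \<Rightarrow> nat"
    by (simp add: simple_function_def space) (simp add: M'_def)
  moreover have "joint_entropy M X A = joint_entropy M' (\<lambda>i g. g i) A" if A: "A \<subseteq> N4" for A
  proof -
    let ?Y = "subvector (\<lambda>i g. g i) A" and ?S = "count_space (subvector X A ` space M)"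
    have comp: "subvector X A = ?Y \<circ> f" using sub[OF A] by (auto simp: subvector_def)
    have img: "?Y ` space M' = subvector X A ` space M"
      unfolding space comp by (simp add: image_comp)
    have "distr M' ?S ?Y = distr M ?S (?Y \<circ> f)"
      unfolding M'_def by (rule distr_distr) (use f in \<open>auto simp: comp\<close>)
    then show ?thesis
      unfolding joint_entropy_def entropy_def prob_space.entropy_def[OF M'] img by (simp add: comp)
  qed
  ultimately show ?thesis
    unfolding entropic_def using M' h
    by (intro exI[of _ M'] exI[of _ "\<lambda>i g. g i"]) simp
qed

lemma uniform_rank_Gamma4: "uniform_rank k \<alpha> \<in> Gamma4"
proof -
  have "uniform_rank k \<alpha> A \<le> uniform_rank k \<alpha> B" if "A \<subseteq> B" "B \<subseteq> N4" for A B
  proof -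
    have "finite B" using that(2) by (rule finite_subset) (simp add: N4_def)
    then have "card (A \<inter> \<alpha>) \<le> card (B \<inter> \<alpha>)" using that(1) by (intro card_mono) auto
    then show ?thesis by (simp add: uniform_rank_def)
  qed
  moreover have "uniform_rank k \<alpha> (A \<inter> B) + uniform_rank k \<alpha> (A \<union> B)
      \<le> uniform_rank k \<alpha> A + uniform_rank k \<alpha> B" if "A \<subseteq> N4" "B \<subseteq> N4" for A B
  proof -
    have fin: "finite A" "finite B" using that by (auto intro: finite_subset simp: N4_def)
    have "card (A \<inter> \<alpha>) + card (B \<inter> \<alpha>) = card ((A \<union> B) \<inter> \<alpha>) + card ((A \<inter> B) \<inter> \<alpha>)"
      using card_Un_Int[of "A \<inter> \<alpha>" "B \<inter> \<alpha>"] fin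
      by (simp add: Int_Un_distrib2 Int_Un_distrib Int_ac)
    moreover have "card ((A \<inter> B) \<inter> \<alpha>) \<le> card (A \<inter> \<alpha>)" "card ((A \<inter> B) \<inter> \<alpha>) \<le> card (B \<inter> \<alpha>)"
      using fin by (auto intro!: card_mono)
    ultimately show ?thesis by (simp add: uniform_rank_def min_def)
  qed
  ultimately show ?thesis by (simp add: Gamma4_def uniform_rank_def)
qed

lemma W2_rank_Gamma4:
  assumes "card \<alpha> = 2"
  shows "W2_rank \<alpha> \<in> Gamma4"
proof -
  obtain x y where xy: "\<alpha> = {x, y}" "x \<noteq> y" using assms by (auto simp: card_2_iff)
  define f where "f = (\<lambda>z. if z = y then x else z)"
  have W: "W2_rank \<alpha> A = real (min 2 (card (f ` A)))" if A: "A \<subseteq> N4" for A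
  proof -
    have fin: "finite A" using A by (rule finite_subset) (simp add: N4_def)
    consider "A = {}" | z where "A = {z}" | "A = \<alpha>"
      | z w where "z \<in> A" "w \<in> A" "f z \<noteq> f w"
    proof (cases "\<exists>z\<in>A. \<exists>w\<in>A. f z \<noteq> f w")
      case True
      then obtain z w where "z \<in> A" "w \<in> A" "f z \<noteq> f w" by blast
      then show ?thesis by (rule that(4))
    next
      case False
      then have "A = {} \<or> (\<exists>z. A = {z}) \<or> A = \<alpha>"
      proof (cases "A \<subseteq> {x, y}")
        case True
        then have "A \<in> Pow {x, y}" by simp
        then have "A = {} \<or> A = {x} \<or> A = {y} \<or> A = {x, y}"
          by (simp add: Pow_insert insert_commute)
        then show ?thesis using xy by blast
      next
        case nsub: False
        then obtain z where z: "z \<in> A" "z \<noteq> x" "z \<noteq> y" by auto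
        have "w = z" if "w \<in> A" for w
        proof -
          have "f w = f z" using False z that by blast
          then show ?thesis using z by (simp add: f_def split: if_splits)
        qed
        then show ?thesis using z by blast
      qed
      then show ?thesis using that(1-3) by blast
    qed
    then show ?thesis
    proof cases
      case 4
      have "card {f z, f w} \<le> card (f ` A)" using 4 fin by (intro card_mono) auto
      moreover have "A \<noteq> \<alpha>" "A \<noteq> {}" using 4 by (auto simp: xy f_def split: if_splits)
      moreover have "card A \<noteq> 1" using 4 by (auto simp: card_1_singleton_iff)
      ultimately show ?thesis using 4 by (simp add: W2_rank_def)
    next
      case 3
      then have "f ` A = {x}" by (auto simp: xy f_def)
      then show ?thesis using 3 xy by (simp add: W2_rank_def)
    qed (simp_all add: W2_rank_def)
  qed
  have mono: "card (f ` A) \<le> card (f ` B)" if "A \<subseteq> B" "B \<subseteq> N4" for A B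
  proof -
    have "finite B" using that(2) by (rule finite_subset) (simp add: N4_def)
    then show ?thesis using that(1) by (intro card_mono) auto
  qed
  have sub: "card (f ` (A \<inter> B)) + card (f ` (A \<union> B)) \<le> card (f ` A) + card (f ` B)"
    if "A \<subseteq> N4" "B \<subseteq> N4" for A B
  proof -
    have fin: "finite A" "finite B" using that by (auto intro: finite_subset simp: N4_def)
    have "card (f ` (A \<inter> B)) \<le> card (f ` A \<inter> f ` B)" using fin by (intro card_mono) auto
    then show ?thesis using card_Un_Int[of "f ` A" "f ` B"] fin by (simp add: image_Un)
  qed
  have "W2_rank \<alpha> (A \<inter> B) + W2_rank \<alpha> (A \<union> B) \<le> W2_rank \<alpha> A + W2_rank \<alpha> B"
    if "A \<subseteq> N4" "B \<subseteq> N4" for A B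
  proof -
    have "A \<inter> B \<subseteq> N4" "A \<union> B \<subseteq> N4" using that by auto
    then show ?thesis
      using that sub[of A B] mono[of "A \<inter> B" A] mono[of "A \<inter> B" B]
      by (simp add: W min_def)
  qed
  moreover have "W2_rank \<alpha> A \<le> W2_rank \<alpha> B" if "A \<subseteq> B" "B \<subseteq> N4" for A B
  proof -
    have "A \<subseteq> N4" using that by auto
    then show ?thesis using that mono[of A B] by (simp add: W)
  qed
  ultimately show ?thesis by (simp add: Gamma4_def) (simp add: W2_rank_def)
qed

lemma face_subset_Gamma4:
  assumes "r\<^sub>1 \<in> Gamma4" "r\<^sub>2 \<in> Gamma4"
  shows "face r\<^sub>1 r\<^sub>2 \<subseteq> Gamma4"
proof
  fix h assume "h \<in> face r\<^sub>1 r\<^sub>2"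
  then obtain a b where ab: "a \<ge> 0" "b \<ge> 0"
    and h: "\<And>A. A \<subseteq> N4 \<Longrightarrow> h A = a * r\<^sub>1 A + b * r\<^sub>2 A"
    by (auto simp: face_def face_point_def)
  have "h A \<le> h B" if "A \<subseteq> B" "B \<subseteq> N4" for A B
  proof -
    have "A \<subseteq> N4" using that by auto
    moreover have "r\<^sub>1 A \<le> r\<^sub>1 B" "r\<^sub>2 A \<le> r\<^sub>2 B" using assms that by (auto simp: Gamma4_def)
    ultimately show ?thesis using that ab by (simp add: h add_mono mult_left_mono)
  qed
  moreover have "h (A \<inter> B) + h (A \<union> B) \<le> h A + h B" if "A \<subseteq> N4" "B \<subseteq> N4" for A B
  proof -
    have AB: "A \<inter> B \<subseteq> N4" "A \<union> B \<subseteq> N4" using that by auto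
    have "r\<^sub>1 (A \<inter> B) + r\<^sub>1 (A \<union> B) \<le> r\<^sub>1 A + r\<^sub>1 B"
      "r\<^sub>2 (A \<inter> B) + r\<^sub>2 (A \<union> B) \<le> r\<^sub>2 A + r\<^sub>2 B"
      using assms that by (auto simp: Gamma4_def)
    then have "a * (r\<^sub>1 (A \<inter> B) + r\<^sub>1 (A \<union> B)) + b * (r\<^sub>2 (A \<inter> B) + r\<^sub>2 (A \<union> B))
        \<le> a * (r\<^sub>1 A + r\<^sub>1 B) + b * (r\<^sub>2 A + r\<^sub>2 B)"
      using ab by (intro add_mono[OF mult_left_mono mult_left_mono])
    then show ?thesis using that AB by (simp add: h algebra_simps)
  qed
  moreover have "h {} = 0" using assms by (simp add: h Gamma4_def)
  ultimately show "h \<in> Gamma4" by (simp add: Gamma4_def)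
qed

lemma W2_rank_alt:
  "W2_rank \<alpha> A = (if A = {} then 0 else if card A = 1 \<or> A \<subseteq> \<alpha> \<and> \<alpha> \<subseteq> A then 1 else 2)"
  by (auto simp: W2_rank_def)

lemma subset_N4_cases:
  assumes "A \<subseteq> N4"
  obtains "A = {}" | "A = {1}" | "A = {2}" | "A = {3}" | "A = {4}" | "A = {1, 2}" | "A = {1, 3}"
    | "A = {1, 4}" | "A = {2, 3}" | "A = {2, 4}" | "A = {3, 4}"
    | "A = {1, 2, 3}" | "A = {1, 2, 4}" | "A = {1, 3, 4}" | "A = {2, 3, 4}" | "A = {1, 2, 3, 4}"
proof -
  have "A = (if 1 \<in> A then {1} else {}) \<union> (if 2 \<in> A then {2} else {})
      \<union> (if 3 \<in> A then {3} else {}) \<union> (if 4 \<in> A then {4} else {})"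
    using assms by (auto simp: N4_def)
  then show ?thesis
    using that
    by (cases "1 \<in> A"; cases "2 \<in> A"; cases "3 \<in> A"; cases "4 \<in> A")
       (simp_all only: if_True if_False Un_empty_left Un_empty_right Un_insert_left)
qed

lemma is_face_of_Gamma4I:
  assumes r: "r\<^sub>1 \<in> Gamma4" "r\<^sub>2 \<in> Gamma4"
    and extreme: "\<And>g h. g \<in> Gamma4 \<Longrightarrow> h \<in> Gamma4 \<Longrightarrow> (\<lambda>A. g A + h A) \<in> face r\<^sub>1 r\<^sub>2 \<Longrightarrow> g \<in> face r\<^sub>1 r\<^sub>2"
  shows "is_face_of_Gamma4 (face r\<^sub>1 r\<^sub>2)"
  unfolding is_face_of_Gamma4_def
proof (intro conjI ballI impI)
  fix g h assume gh: "g \<in> Gamma4" "h \<in> Gamma4" "(\<lambda>A. g A + h A) \<in> face r\<^sub>1 r\<^sub>2"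
  show "g \<in> face r\<^sub>1 r\<^sub>2" using gh by (rule extreme)
  have "(\<lambda>A. h A + g A) \<in> face r\<^sub>1 r\<^sub>2" using gh(3) by (simp add: add.commute)
  with gh(2,1) show "h \<in> face r\<^sub>1 r\<^sub>2" by (rule extreme)
qed (rule face_subset_Gamma4[OF r])

lemma Gamma4_mono: "g \<in> Gamma4 \<Longrightarrow> A \<subseteq> B \<Longrightarrow> B \<subseteq> N4 \<Longrightarrow> g A \<le> g B"
  and Gamma4_submod: "g \<in> Gamma4 \<Longrightarrow> A \<subseteq> N4 \<Longrightarrow> B \<subseteq> N4 \<Longrightarrow> g (A \<inter> B) + g (A \<union> B) \<le> g A + g B"
  by (simp_all add: Gamma4_def)

lemma face_summand:
  assumes g: "g \<in> Gamma4" and h: "h \<in> Gamma4"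
    and gh: "(\<lambda>A. g A + h A) \<in> face r\<^sub>1 r\<^sub>2"
  shows face_summand_mono: "A \<subseteq> B \<Longrightarrow> B \<subseteq> N4 \<Longrightarrow> r\<^sub>1 A = r\<^sub>1 B \<Longrightarrow> r\<^sub>2 A = r\<^sub>2 B \<Longrightarrow> g A = g B"
    and face_summand_add: "A \<inter> B = {} \<Longrightarrow> A \<union> B \<subseteq> N4 \<Longrightarrow> r\<^sub>1 (A \<union> B) = r\<^sub>1 A + r\<^sub>1 B \<Longrightarrow>
      r\<^sub>2 (A \<union> B) = r\<^sub>2 A + r\<^sub>2 B \<Longrightarrow> g (A \<union> B) = g A + g B"
proof -
  obtain a b where ab: "\<And>A. A \<subseteq> N4 \<Longrightarrow> g A + h A = a * r\<^sub>1 A + b * r\<^sub>2 A"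
    using gh by (auto simp: face_def face_point_def)
  show "g A = g B" if "A \<subseteq> B" "B \<subseteq> N4" "r\<^sub>1 A = r\<^sub>1 B" "r\<^sub>2 A = r\<^sub>2 B"
  proof -
    have "g A \<le> g B" "h A \<le> h B" using g h that by (auto simp: Gamma4_def)
    moreover have "g A + h A = g B + h B" using ab[of A] ab[of B] that by auto
    ultimately show ?thesis by linarith
  qed
  show "g (A \<union> B) = g A + g B" if AB: "A \<inter> B = {}" "A \<union> B \<subseteq> N4"
    and r: "r\<^sub>1 (A \<union> B) = r\<^sub>1 A + r\<^sub>1 B" "r\<^sub>2 (A \<union> B) = r\<^sub>2 A + r\<^sub>2 B"
  proof -
    have sub: "k (A \<union> B) \<le> k A + k B" if "k \<in> Gamma4" for k
    proof -
      have "k {} = 0" "k (A \<inter> B) + k (A \<union> B) \<le> k A + k B"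
        using that AB(2) by (auto simp: Gamma4_def)
      then show ?thesis by (simp add: AB(1))
    qed
    have "g (A \<union> B) + h (A \<union> B) = (g A + h A) + (g B + h B)"
      using ab[of A] ab[of B] ab[of "A \<union> B"] AB(2) r by (simp add: distrib_left)
    with sub[OF g] sub[OF h] show ?thesis by linarith
  qed
qed

text \<open>The three cones of the theorem are faces of \<open>Gamma4\<close>.\<close>

lemma is_face_U23_U12:
  "is_face_of_Gamma4 (face (uniform_rank 2 {1, 2, 3}) (uniform_rank 1 {1, 2}))"
proof (rule is_face_of_Gamma4I)
  fix g h assume g: "g \<in> Gamma4" and h: "h \<in> Gamma4"
    and "(\<lambda>A. g A + h A) \<in> face (uniform_rank 2 {1, 2, 3}) (uniform_rank 1 {1, 2})"
  note mono = face_summand_mono[OF this] and add = face_summand_add[OF this]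
  have g0: "g {} = 0" using g by (simp add: Gamma4_def)
  have g12: "g {1, 2} \<le> g {1} + g {2}"
  proof -
    have "g ({1} \<inter> {2}) + g ({1} \<union> {2}) \<le> g {1} + g {2}"
      by (rule Gamma4_submod[OF g]) (simp_all add: N4_def)
    then show ?thesis using g0 by (simp add: insert_commute)
  qed
  have "g {} \<le> g {3}" by (rule Gamma4_mono[OF g]) (simp_all add: N4_def)
  then have g3: "g {3} \<ge> 0" by (simp add: g0)
  have sub: "g {1, 3} = g {1} + g {3}" "g {2, 3} = g {2} + g {3}"
    using add[of "{1}" "{3}"] add[of "{2}" "{3}"]
    by (simp_all add: N4_def uniform_rank_def W2_rank_alt insert_commute)
  have eqs:
    "g {} = g {4}"
    "g {1} = g {1, 4}"
    "g {2} = g {2, 4}"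
    "g {3} = g {3, 4}"
    "g {1, 2} = g {1, 2, 3}"
    "g {1, 2} = g {1, 2, 4}"
    "g {1, 3} = g {1, 2, 3}"
    "g {1, 3} = g {1, 3, 4}"
    "g {2, 3} = g {1, 2, 3}"
    "g {2, 3} = g {2, 3, 4}"
    "g {1, 2, 3} = g {1, 2, 3, 4}"
    "g {1, 2, 4} = g {1, 2, 3, 4}"
    "g {1, 3, 4} = g {1, 2, 3, 4}"
    "g {2, 3, 4} = g {1, 2, 3, 4}"
    by (rule mono; simp add: N4_def uniform_rank_def W2_rank_alt)+
  have val: "g A = face_point (uniform_rank 2 {1, 2, 3}) (uniform_rank 1 {1, 2}) (g {3})
      (g {1} - g {3}) A"
    if "A \<subseteq> N4" for A
    using that eqs sub g0
    by (cases rule: subset_N4_cases)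
       (simp_all add: face_point_def uniform_rank_def W2_rank_alt)
  have "g {1} - g {3} \<ge> 0" using eqs sub g12 by simp
  with g3 val show "g \<in> face (uniform_rank 2 {1, 2, 3}) (uniform_rank 1 {1, 2})"
    unfolding face_def by blast
qed (auto intro: uniform_rank_Gamma4 W2_rank_Gamma4)

lemma is_face_W2_U12:
  "is_face_of_Gamma4 (face (W2_rank {3, 4}) (uniform_rank 1 {1, 2}))"
proof (rule is_face_of_Gamma4I)
  fix g h assume g: "g \<in> Gamma4" and h: "h \<in> Gamma4"
    and "(\<lambda>A. g A + h A) \<in> face (W2_rank {3, 4}) (uniform_rank 1 {1, 2})"
  note mono = face_summand_mono[OF this] and add = face_summand_add[OF this]
  have g0: "g {} = 0" using g by (simp add: Gamma4_def)
  have g12: "g {1, 2} \<le> g {1} + g {2}"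
  proof -
    have "g ({1} \<inter> {2}) + g ({1} \<union> {2}) \<le> g {1} + g {2}"
      by (rule Gamma4_submod[OF g]) (simp_all add: N4_def)
    then show ?thesis using g0 by (simp add: insert_commute)
  qed
  have "g {} \<le> g {3}" by (rule Gamma4_mono[OF g]) (simp_all add: N4_def)
  then have g3: "g {3} \<ge> 0" by (simp add: g0)
  have sub: "g {1, 3} = g {1} + g {3}" "g {2, 3} = g {2} + g {3}"
    using add[of "{1}" "{3}"] add[of "{2}" "{3}"]
    by (simp_all add: N4_def uniform_rank_def W2_rank_alt insert_commute)
  have eqs:
    "g {3} = g {3, 4}"
    "g {4} = g {3, 4}"
    "g {1, 2} = g {1, 2, 3}"
    "g {1, 2} = g {1, 2, 4}"
    "g {1, 3} = g {1, 2, 3}"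
    "g {1, 3} = g {1, 3, 4}"
    "g {1, 4} = g {1, 2, 4}"
    "g {1, 4} = g {1, 3, 4}"
    "g {2, 3} = g {1, 2, 3}"
    "g {2, 3} = g {2, 3, 4}"
    "g {2, 4} = g {1, 2, 4}"
    "g {2, 4} = g {2, 3, 4}"
    "g {1, 2, 3} = g {1, 2, 3, 4}"
    "g {1, 2, 4} = g {1, 2, 3, 4}"
    "g {1, 3, 4} = g {1, 2, 3, 4}"
    "g {2, 3, 4} = g {1, 2, 3, 4}"
    by (rule mono; simp add: N4_def uniform_rank_def W2_rank_alt)+
  have val: "g A = face_point (W2_rank {3, 4}) (uniform_rank 1 {1, 2}) (g {3})
      (g {1} - g {3}) A"
    if "A \<subseteq> N4" for A
    using that eqs sub g0
    by (cases rule: subset_N4_cases)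
       (simp_all add: face_point_def uniform_rank_def W2_rank_alt)
  have "g {1} - g {3} \<ge> 0" using eqs sub g12 by simp
  with g3 val show "g \<in> face (W2_rank {3, 4}) (uniform_rank 1 {1, 2})"
    unfolding face_def by blast
qed (auto intro: uniform_rank_Gamma4 W2_rank_Gamma4)

lemma is_face_W2_U13:
  "is_face_of_Gamma4 (face (W2_rank {1, 4}) (uniform_rank 1 {1, 2, 4}))"
proof (rule is_face_of_Gamma4I)
  fix g h assume g: "g \<in> Gamma4" and h: "h \<in> Gamma4"
    and "(\<lambda>A. g A + h A) \<in> face (W2_rank {1, 4}) (uniform_rank 1 {1, 2, 4})"
  note mono = face_summand_mono[OF this] and add = face_summand_add[OF this]
  have g0: "g {} = 0" using g by (simp add: Gamma4_def)
  have g12: "g {1, 2} \<le> g {1} + g {2}"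
  proof -
    have "g ({1} \<inter> {2}) + g ({1} \<union> {2}) \<le> g {1} + g {2}"
      by (rule Gamma4_submod[OF g]) (simp_all add: N4_def)
    then show ?thesis using g0 by (simp add: insert_commute)
  qed
  have "g {} \<le> g {3}" by (rule Gamma4_mono[OF g]) (simp_all add: N4_def)
  then have g3: "g {3} \<ge> 0" by (simp add: g0)
  have sub: "g {1, 3} = g {1} + g {3}" "g {2, 3} = g {2} + g {3}"
    using add[of "{1}" "{3}"] add[of "{2}" "{3}"]
    by (simp_all add: N4_def uniform_rank_def W2_rank_alt insert_commute)
  have eqs:
    "g {1} = g {1, 4}"
    "g {4} = g {1, 4}"
    "g {1, 2} = g {1, 2, 3}"
    "g {1, 2} = g {1, 2, 4}"
    "g {1, 3} = g {1, 2, 3}"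
    "g {1, 3} = g {1, 3, 4}"
    "g {2, 3} = g {1, 2, 3}"
    "g {2, 3} = g {2, 3, 4}"
    "g {2, 4} = g {1, 2, 4}"
    "g {2, 4} = g {2, 3, 4}"
    "g {3, 4} = g {1, 3, 4}"
    "g {3, 4} = g {2, 3, 4}"
    "g {1, 2, 3} = g {1, 2, 3, 4}"
    "g {1, 2, 4} = g {1, 2, 3, 4}"
    "g {1, 3, 4} = g {1, 2, 3, 4}"
    "g {2, 3, 4} = g {1, 2, 3, 4}"
    by (rule mono; simp add: N4_def uniform_rank_def W2_rank_alt)+
  have val: "g A = face_point (W2_rank {1, 4}) (uniform_rank 1 {1, 2, 4}) (g {3})
      (g {1} - g {3}) A"
    if "A \<subseteq> N4" for A
    using that eqs sub g0
    by (cases rule: subset_N4_cases)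
       (simp_all add: face_point_def uniform_rank_def W2_rank_alt)
  have "g {1} - g {3} \<ge> 0" using eqs sub g12 by simp
  with g3 val show "g \<in> face (W2_rank {1, 4}) (uniform_rank 1 {1, 2, 4})"
    unfolding face_def by blast
qed (auto intro: uniform_rank_Gamma4 W2_rank_Gamma4)

end

theory Submission
  imports Defs "HOL-Real_Asymp.Real_Asymp"
begin

text \<open>On each face, \<open>X\<^sub>3\<close> is independent of \<open>X\<^sub>1\<close> and of \<open>X\<^sub>2\<close>, any two of
  \<open>X\<^sub>1, X\<^sub>2, X\<^sub>3\<close> determine the third, and \<open>X\<^sub>4\<close> is constant, a copy of \<open>X\<^sub>3\<close> or a copy of
  \<open>X\<^sub>1\<close>. If \<open>X\<^sub>3\<close> takes \<open>m\<close> values, then every value of \<open>X\<^sub>1\<close> has probability at most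
  \<open>1/m\<close>, so \<open>a = H(X\<^sub>3) \<le> log m \<le> H(X\<^sub>1) = a + b\<close>; since \<open>m\<close> is an integer,
  \<open>m \<ge> \<lceil>2\<^sup>a\<rceil>\<close>. Conversely, with \<open>m = \<lceil>2\<^sup>a\<rceil>\<close>, take \<open>X\<^sub>3 = Z\<close> of entropy \<open>a\<close> on
  \<open>{0..<m}\<close>, \<open>X\<^sub>1 = (U, W)\<close> and \<open>X\<^sub>2 = (U + Z mod m, W)\<close>, where \<open>U\<close> is uniform on
  \<open>{0..<m}\<close>, \<open>W\<close> has entropy \<open>a + b - log m\<close>, and \<open>U, W, Z\<close> are independent.\<close>

section \<open>Entropy on finite probability spaces\<close>

text \<open>Strictly positive weights make \<open>D\<close> the support itself: attained values have
  positive mass, no logarithm of 0 occurs, and "almost surely" becomes "for every outcome in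
  \<open>D\<close>".\<close>

locale finite_distribution =
  fixes D :: "'d set" and p :: "'d \<Rightarrow> real"
  assumes finite_support [simp]: "finite D"
    and weight_pos: "d \<in> D \<Longrightarrow> p d > 0"
    and sum_weights: "sum p D = 1"
begin

definition mass :: "('d \<Rightarrow> 'c) \<Rightarrow> 'c \<Rightarrow> real" where
  "mass f y = (\<Sum>d | d \<in> D \<and> f d = y. p d)"

text \<open>Summing over outcomes rather than values gives all functions on \<open>D\<close> the
  same index set, so entropies can be compared term by term; \<open>ent_values\<close> recovers the
  usual formula.\<close>

definition ent :: "('d \<Rightarrow> 'c) \<Rightarrow> real" where
  "ent f = - (\<Sum>d\<in>D. p d * log 2 (mass f (f d)))"

lemma nonempty: "D \<noteq> {}"
  using sum_weights by auto

lemma mass_pos: "y \<in> f ` D \<Longrightarrow> mass f y > 0"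
  unfolding mass_def by (rule sum_pos) (auto intro: weight_pos)

lemma sum_by_values: "(\<Sum>d\<in>D. p d * \<phi> (f d)) = (\<Sum>y\<in>f ` D. mass f y * \<phi> y)"
proof -
  have "(\<Sum>d\<in>D. p d * \<phi> (f d)) = (\<Sum>y\<in>f ` D. \<Sum>d | d \<in> D \<and> f d = y. p d * \<phi> (f d))"
    by (rule sum.image_gen) simp
  also have "\<dots> = (\<Sum>y\<in>f ` D. mass f y * \<phi> y)"
    unfolding mass_def sum_distrib_right by (intro sum.cong) auto
  finally show ?thesis .
qed

lemma sum_mass: "(\<Sum>y\<in>f ` D. mass f y) = 1"
  using sum_by_values[of "\<lambda>_. 1" f] sum_weights by simp

lemma ent_values: "ent f = - (\<Sum>y\<in>f ` D. mass f y * log 2 (mass f y))"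
  unfolding ent_def by (subst sum_by_values) simp

text \<open>The mass of \<open>f d\<close> is the weight of the fibre of \<open>f\<close> through
  \<open>d\<close>, so only the partition of \<open>D\<close> into fibres counts. The values of
  \<open>f\<close> and \<open>g\<close> may have different types.\<close>

lemma ent_cong:
  assumes "\<And>d d'. d \<in> D \<Longrightarrow> d' \<in> D \<Longrightarrow> f d = f d' \<longleftrightarrow> g d = g d'"
  shows "ent f = ent g"
proof -
  have "mass f (f d) = mass g (g d)" if "d \<in> D" for d
    unfolding mass_def using assms that by (intro sum.cong) auto
  then show ?thesis by (simp add: ent_def)
qed

lemma ent_const: "ent (\<lambda>_. c) = 0"
  using sum_weights by (simp add: ent_def mass_def)

lemma mass_mono:
  assumes "\<And>d'. d' \<in> D \<Longrightarrow> f d' = f d \<Longrightarrow> g d' = g d"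
  shows "mass f (f d) \<le> mass g (g d)"
  unfolding mass_def by (rule sum_mono2) (use assms in \<open>auto intro: less_imp_le weight_pos\<close>)

lemma ent_ident: "ent (\<lambda>d. d) = - (\<Sum>d\<in>D. p d * log 2 (p d))"
proof -
  have "mass (\<lambda>d. d) d = p d" if "d \<in> D" for d
  proof -
    have "{d'. d' \<in> D \<and> d' = d} = {d}" using that by auto
    then show ?thesis by (simp add: mass_def)
  qed
  then show ?thesis by (simp add: ent_def)
qed

text \<open>Average \<open>ln x <= x - 1\<close> over \<open>p\<close>. Equality there holds only at
  \<open>x = 1\<close>, and since the weights are positive, a vanishing average forces equality at
  every outcome.\<close>

lemma gibbs:
  assumes w: "\<And>d. d \<in> D \<Longrightarrow> w d > 0" and le: "(\<Sum>d\<in>D. p d * w d) \<le> 1"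
  shows gibbs_le: "(\<Sum>d\<in>D. p d * log 2 (w d)) \<le> 0"
    and gibbs_eq: "(\<Sum>d\<in>D. p d * log 2 (w d)) = 0 \<Longrightarrow> d \<in> D \<Longrightarrow> w d = 1"
proof -
  have log: "(\<Sum>d\<in>D. p d * log 2 (w d)) = (\<Sum>d\<in>D. p d * ln (w d)) / ln 2"
    by (simp add: log_def sum_divide_distrib)
  have pt: "p d * (w d - 1 - ln (w d)) \<ge> 0" if "d \<in> D" for d
    using ln_le_minus_one[OF w[OF that]] weight_pos[OF that] by simp
  have split: "(\<Sum>d\<in>D. p d * (w d - 1 - ln (w d)))
      = (\<Sum>d\<in>D. p d * w d) - 1 - (\<Sum>d\<in>D. p d * ln (w d))"
    by (simp add: sum_subtractf right_diff_distrib sum_weights)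
  then have "(\<Sum>d\<in>D. p d * ln (w d)) \<le> 0"
    using sum_nonneg[of D "\<lambda>d. p d * (w d - 1 - ln (w d))"] pt le by simp
  then show "(\<Sum>d\<in>D. p d * log 2 (w d)) \<le> 0"
    unfolding log by (simp add: divide_nonpos_pos)
  assume eq: "(\<Sum>d\<in>D. p d * log 2 (w d)) = 0" and d: "d \<in> D"
  have "(\<Sum>d\<in>D. p d * ln (w d)) = 0" using eq unfolding log by simp
  then have "(\<Sum>d\<in>D. p d * (w d - 1 - ln (w d))) = 0"
    using split sum_nonneg[of D "\<lambda>d. p d * (w d - 1 - ln (w d))"] pt le by simp
  then have "p d * (w d - 1 - ln (w d)) = 0"
    using sum_nonneg_eq_0_iff[of D "\<lambda>d. p d * (w d - 1 - ln (w d))"] pt d by simp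
  then have "ln (w d) = w d - 1" using weight_pos[OF d] by simp
  then show "w d = 1" using w[OF d] by (simp add: ln_eq_minus_one)
qed

text \<open>Gibbs' inequality for the ratio of the uniform distribution on the values of
  \<open>f\<close> to the actual one.\<close>

lemma ent_le_log_card: "ent f \<le> log 2 (card (f ` D))"
proof -
  define n where "n = real (card (f ` D))"
  have n: "n > 0" using nonempty by (simp add: n_def card_gt_0_iff)
  have m: "mass f (f d) > 0" if "d \<in> D" for d using mass_pos[of "f d" f] that by auto
  have "(\<Sum>d\<in>D. p d * (1 / (n * mass f (f d)))) = (\<Sum>y\<in>f ` D. mass f y * (1 / (n * mass f y)))"
    by (rule sum_by_values[of "\<lambda>y. 1 / (n * mass f y)"])
  also have "\<dots> = (\<Sum>y\<in>f ` D. 1 / n)"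
    using mass_pos[of _ f] by (intro sum.cong refl) (auto simp: less_le)
  also have "\<dots> = 1" using nonempty by (simp add: n_def)
  finally have "(\<Sum>d\<in>D. p d * log 2 (1 / (n * mass f (f d)))) \<le> 0"
    using n m by (intro gibbs_le[of "\<lambda>d. 1 / (n * mass f (f d))"]) auto
  moreover have "(\<Sum>d\<in>D. p d * log 2 (1 / (n * mass f (f d))))
      = (\<Sum>d\<in>D. - (p d * log 2 n) - p d * log 2 (mass f (f d)))"
  proof (intro sum.cong refl)
    fix d assume "d \<in> D"
    from m[OF this] n show "p d * log 2 (1 / (n * mass f (f d)))
        = - (p d * log 2 n) - p d * log 2 (mass f (f d))"
      by (simp add: log_divide log_mult right_diff_distrib distrib_left)
  qed
  moreover have "\<dots> = - log 2 n + ent f"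
    by (simp add: sum_subtractf sum_negf ent_def sum_weights flip: sum_distrib_right)
  ultimately show ?thesis by (simp add: n_def)
qed

lemma log_le_ent:
  assumes "\<And>y. y \<in> f ` D \<Longrightarrow> mass f y \<le> 1 / m" and "m > 0"
  shows "log 2 m \<le> ent f"
proof -
  have "p d * log 2 (mass f (f d)) \<le> p d * log 2 (1 / m)" if "d \<in> D" for d
    using that assms weight_pos[OF that] mass_pos[of "f d" f]
    by (intro mult_left_mono) auto
  then have "(\<Sum>d\<in>D. p d * log 2 (mass f (f d))) \<le> (\<Sum>d\<in>D. p d * log 2 (1 / m))"
    by (rule sum_mono)
  also have "\<dots> = - log 2 m"
    using assms(2) sum_weights by (simp add: log_divide sum_negf flip: sum_distrib_right)
  finally show ?thesis by (simp add: ent_def)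
qed

text \<open>Fibres of \<open>g\<close> lie inside fibres of \<open>f\<close>, so no summand of
  \<open>ent f\<close> exceeds the corresponding one of \<open>ent g\<close>; equal totals force
  equal masses at every outcome. If \<open>g\<close> separated \<open>d'\<close> from
  \<open>d\<close> inside one fibre of \<open>f\<close>, the mass would drop by at least
  \<open>p d' > 0\<close>.\<close>

lemma ent_eq_imp_determined:
  assumes ref: "\<And>d d'. d \<in> D \<Longrightarrow> d' \<in> D \<Longrightarrow> g d = g d' \<Longrightarrow> f d = f d'"
    and eq: "ent f = ent g" and d: "d \<in> D" "d' \<in> D" "f d = f d'"
  shows "g d = g d'"
proof -
  have le: "mass g (g e) \<le> mass f (f e)" if "e \<in> D" for e
    by (rule mass_mono) (use ref that in blast)
  have "(\<Sum>e\<in>D. p e * (log 2 (mass f (f e)) - log 2 (mass g (g e)))) = 0"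
    using eq by (simp add: ent_def right_diff_distrib sum_subtractf)
  moreover have "p e * (log 2 (mass f (f e)) - log 2 (mass g (g e))) \<ge> 0" if "e \<in> D" for e
    using le[OF that] weight_pos[OF that] mass_pos[of "g e" g] mass_pos[of "f e" f] that by simp
  ultimately have "p d * (log 2 (mass f (f d)) - log 2 (mass g (g d))) = 0"
    using sum_nonneg_eq_0_iff[of D "\<lambda>e. p e * (log 2 (mass f (f e)) - log 2 (mass g (g e)))"] d(1)
    by simp
  then have "mass f (f d) = mass g (g d)"
    using weight_pos[OF d(1)] mass_pos[of "g d" g] mass_pos[of "f d" f] d(1)
    by (simp add: log_def)
  moreover have "mass g (g d) < mass f (f d)" if "g d' \<noteq> g d"
    unfolding mass_def
  proof (rule sum_strict_mono2[of _ _ d'])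
    show "{e \<in> D. g e = g d} \<subseteq> {e \<in> D. f e = f d}" using ref d by blast
  qed (use that d in \<open>auto intro: weight_pos less_imp_le\<close>)
  ultimately show ?thesis by (metis less_irrefl)
qed

text \<open>The equality case of Gibbs' inequality for \<open>w\<close>, the ratio of the product of
  the marginals to the joint mass: additivity says that the average of \<open>log w\<close> is 0, so
  \<open>w = 1\<close> everywhere. The attained pairs then carry product mass 1; a missing pair
  would have positive product mass and push the total above 1.\<close>

lemma ent_add_imp_indep:
  assumes "ent (\<lambda>d. (f d, g d)) = ent f + ent g"
  shows indep_mass: "d \<in> D \<Longrightarrow> mass (\<lambda>d. (f d, g d)) (f d, g d) = mass f (f d) * mass g (g d)"
    and indep_support: "(\<lambda>d. (f d, g d)) ` D = f ` D \<times> g ` D"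
proof -
  let ?fg = "\<lambda>d. (f d, g d)"
  define w where "w d = mass f (f d) * mass g (g d) / mass ?fg (?fg d)" for d
  have pos: "mass f (f d) > 0" "mass g (g d) > 0" "mass ?fg (f d, g d) > 0" if "d \<in> D" for d
    using that by (auto intro: mass_pos)
  have sub: "?fg ` D \<subseteq> f ` D \<times> g ` D" by auto
  have nn: "0 \<le> mass f x * mass g y" if "(x, y) \<in> f ` D \<times> g ` D" for x y
    using that mass_pos[of x f] mass_pos[of y g] by (intro mult_nonneg_nonneg) auto
  have "(\<Sum>d\<in>D. p d * w d)
      = (\<Sum>z\<in>?fg ` D. mass ?fg z * (mass f (fst z) * mass g (snd z) / mass ?fg z))"
    unfolding w_def by (subst sum_by_values[symmetric]) simp
  also have "\<dots> = (\<Sum>(x, y)\<in>?fg ` D. mass f x * mass g y)"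
    using pos(3) by (intro sum.cong refl) (auto simp: less_le)
  finally have sw: "(\<Sum>d\<in>D. p d * w d) = (\<Sum>(x, y)\<in>?fg ` D. mass f x * mass g y)" .
  have total: "(\<Sum>(x, y)\<in>f ` D \<times> g ` D. mass f x * mass g y) = 1"
    by (simp add: sum_mass flip: sum.cartesian_product sum_distrib_left)
  have "(\<Sum>d\<in>D. p d * w d) \<le> 1"
    unfolding sw total[symmetric] by (rule sum_mono2) (use sub nn in auto)
  moreover have "(\<Sum>d\<in>D. p d * log 2 (w d)) = 0"
  proof -
    have "(\<Sum>d\<in>D. p d * log 2 (w d)) = (\<Sum>d\<in>D. p d * log 2 (mass f (f d))
        + p d * log 2 (mass g (g d)) - p d * log 2 (mass ?fg (?fg d)))"
    proof (intro sum.cong refl)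
      fix d assume "d \<in> D"
      from pos[OF this] show "p d * log 2 (w d) = p d * log 2 (mass f (f d))
          + p d * log 2 (mass g (g d)) - p d * log 2 (mass ?fg (?fg d))"
        by (simp add: w_def log_divide log_mult right_diff_distrib distrib_left)
    qed
    then show ?thesis using assms by (simp add: ent_def sum_subtractf sum.distrib)
  qed
  ultimately have w1: "w d = 1" if "d \<in> D" for d
    using that pos by (intro gibbs_eq) (auto simp: w_def)
  then show "mass ?fg (f d, g d) = mass f (f d) * mass g (g d)" if "d \<in> D"
    using that pos(3)[OF that] w1[OF that] by (simp add: w_def)
  show "?fg ` D = f ` D \<times> g ` D"
  proof (rule ccontr)
    assume "?fg ` D \<noteq> f ` D \<times> g ` D"
    with sub obtain z where z: "z \<in> f ` D \<times> g ` D" "z \<notin> ?fg ` D" by blast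
    have "(\<Sum>(x, y)\<in>?fg ` D. mass f x * mass g y)
        < (\<Sum>(x, y)\<in>f ` D \<times> g ` D. mass f x * mass g y)"
      by (rule sum_strict_mono2[of _ _ z])
        (use z sub nn in \<open>auto intro!: mult_pos_pos mass_pos\<close>)
    then show False
      unfolding sw[symmetric] total using w1 sum_weights by simp
  qed
qed

text \<open>Write \<open>m\<close> for the number of values of \<open>Z\<close> and fix a value \<open>x\<close> of \<open>X\<close>. By
  independence every value \<open>z\<close> of \<open>Z\<close> occurs together with \<open>x\<close>, in exactly one outcome
  \<open>(x, y\<^sub>z, z)\<close>, and comparing its two product formulas shows that \<open>y\<^sub>z\<close> has the same
  probability as \<open>x\<close>. The \<open>y\<^sub>z\<close> are distinct, so this probability is at most \<open>1/m\<close>.\<close>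

lemma log_card_le_ent:
  fixes X Y Z :: "'d \<Rightarrow> 'c"
  assumes XZ: "ent (\<lambda>d. (X d, Z d)) = ent X + ent Z"
    and YZ: "ent (\<lambda>d. (Y d, Z d)) = ent Y + ent Z"
    and det_Z: "ent (\<lambda>d. (X d, Y d)) = ent (\<lambda>d. (X d, Y d, Z d))"
    and det_Y: "ent (\<lambda>d. (X d, Z d)) = ent (\<lambda>d. (X d, Y d, Z d))"
    and det_X: "ent (\<lambda>d. (Y d, Z d)) = ent (\<lambda>d. (X d, Y d, Z d))"
  shows "log 2 (card (Z ` D)) \<le> ent X"
proof (rule log_le_ent)
  show "0 < real (card (Z ` D))" using nonempty by (simp add: card_gt_0_iff)
  fix x assume x: "x \<in> X ` D"
  have detZ: "Z d = Z d'" if "d \<in> D" "d' \<in> D" "X d = X d'" "Y d = Y d'" for d d'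
    using ent_eq_imp_determined[OF _ det_Z that(1,2)] that by simp
  have detY: "Y d = Y d'" if "d \<in> D" "d' \<in> D" "X d = X d'" "Z d = Z d'" for d d'
    using ent_eq_imp_determined[OF _ det_Y that(1,2)] that by simp
  have detX: "X d = X d'" if "d \<in> D" "d' \<in> D" "Y d = Y d'" "Z d = Z d'" for d d'
    using ent_eq_imp_determined[OF _ det_X that(1,2)] that by simp
  have "\<exists>d\<in>D. X d = x \<and> Z d = z" if "z \<in> Z ` D" for z
  proof -
    have "(x, z) \<in> (\<lambda>d. (X d, Z d)) ` D" unfolding indep_support[OF XZ] using x that by simp
    then show ?thesis by auto
  qed
  then obtain e where e: "e z \<in> D" "X (e z) = x" "Z (e z) = z" if "z \<in> Z ` D" for z
    by metis
  have eq: "mass Y (Y (e z)) = mass X x" if z: "z \<in> Z ` D" for z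
  proof -
    have "X d = X (e z) \<and> Z d = Z (e z) \<longleftrightarrow> Y d = Y (e z) \<and> Z d = Z (e z)" if "d \<in> D" for d
      using detX[OF that e(1)[OF z]] detY[OF that e(1)[OF z]] by blast
    then have "mass (\<lambda>d. (X d, Z d)) (X (e z), Z (e z)) = mass (\<lambda>d. (Y d, Z d)) (Y (e z), Z (e z))"
      unfolding mass_def by (intro sum.cong) auto
    then have "mass X (X (e z)) * mass Z (Z (e z)) = mass Y (Y (e z)) * mass Z (Z (e z))"
      using indep_mass[OF XZ e(1)[OF z]] indep_mass[OF YZ e(1)[OF z]] by simp
    moreover have "mass Z z > 0" using z by (rule mass_pos)
    ultimately show ?thesis using e[OF z] by simp
  qed
  have "inj_on (Y \<circ> e) (Z ` D)"
  proof (rule inj_onI)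
    fix z z' assume z: "z \<in> Z ` D" "z' \<in> Z ` D" "(Y \<circ> e) z = (Y \<circ> e) z'"
    then show "z = z'" using detZ[of "e z" "e z'"] e[of z] e[of z'] by simp
  qed
  then have "(\<Sum>y\<in>(Y \<circ> e) ` Z ` D. mass Y y) = (\<Sum>z\<in>Z ` D. mass Y (Y (e z)))"
    by (subst sum.reindex) simp_all
  also have "\<dots> = card (Z ` D) * mass X x" by (simp add: eq)
  finally have "card (Z ` D) * mass X x = (\<Sum>y\<in>(Y \<circ> e) ` Z ` D. mass Y y)" ..
  also have "\<dots> \<le> (\<Sum>y\<in>Y ` D. mass Y y)"
    by (rule sum_mono2) (use e(1) in \<open>auto intro!: less_imp_le[OF mass_pos]\<close>)
  finally show "mass X x \<le> 1 / card (Z ` D)"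
    using nonempty by (simp add: sum_mass field_simps card_gt_0_iff)
qed

end

section \<open>Entropic functions and finite distributions\<close>

lemma entropy_simple_function:
  assumes "prob_space M" and f: "simple_function M f"
  shows "prob_space.entropy M 2 (count_space (f ` space M)) f
    = - (\<Sum>y\<in>f ` space M. measure M (f -` {y} \<inter> space M) * log 2 (measure M (f -` {y} \<inter> space M)))"
proof -
  interpret prob_space M by fact
  interpret information_space M 2 by unfold_locales simp
  show ?thesis
    by (rule entropy_simple_distributed[OF simple_distributedI[OF f measure_nonneg refl]])
qed

lemma simple_function_subvector:
  assumes X: "\<And>i. i \<in> A \<Longrightarrow> simple_function M (X i)" and A: "finite A"
  shows "simple_function M (subvector X A)"
  using A X
proof (induction A)
  case empty
  then show ?case by (simp add: subvector_def)
next
  case (insert i A)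
  have "simple_function M (\<lambda>\<omega>. (subvector X A \<omega>)(i := X i \<omega>))"
    using insert by (intro simple_function_compose2[where h = "\<lambda>g y. g(i := y)"]) auto
  moreover have "(\<lambda>\<omega>. (subvector X A \<omega>)(i := X i \<omega>)) = subvector X (insert i A)"
    using insert by (auto simp: subvector_def fun_eq_iff)
  ultimately show ?case by simp
qed

lemma subvector_eq_iff: "subvector X A d = subvector X A d' \<longleftrightarrow> (\<forall>i\<in>A. X i d = X i d')"
  by (auto simp: subvector_def fun_eq_iff restrict_def)

text \<open>The probability space is \<open>D\<close> with point masses \<open>p\<close>;
  \<open>entropicI\<close> admits a sample space of any type.\<close>

lemma (in finite_distribution) entropic_ent:
  assumes "\<And>A. A \<subseteq> N4 \<Longrightarrow> h A = ent (subvector X A)"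
  shows "entropic h"
proof (rule entropicI)
  let ?M = "point_measure D p"
  have nn: "p d \<ge> 0" if "d \<in> D" for d using weight_pos[OF that] by simp
  show M: "prob_space ?M"
  proof (rule prob_spaceI)
    show "emeasure ?M (space ?M) = 1"
      using nn sum_weights by (simp add: emeasure_point_measure_finite space_point_measure sum_ennreal)
  qed
  show simple: "\<forall>i\<in>N4. simple_function ?M (X i)" by simp
  show "\<forall>A\<subseteq>N4. h A = joint_entropy ?M X A"
  proof (intro allI impI)
    fix A assume A: "A \<subseteq> N4"
    have "measure ?M (subvector X A -` {y} \<inter> space ?M) = mass (subvector X A) y" for y
      using nn by (simp add: measure_point_measure_finite_if space_point_measure mass_def)
        (auto intro!: sum.cong)
    then show "h A = joint_entropy ?M X A"
      unfolding joint_entropy_def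
      by (subst entropy_simple_function[OF M]) (simp_all add: assms[OF A] ent_values space_point_measure)
  qed
qed

text \<open>The sample space is replaced by the law of the whole vector, so that the random
  variables become coordinate projections. Vectors of probability 0 are dropped to make all weights
  positive.\<close>

lemma entropic_imp_finite_distribution:
  assumes "entropic h"
  obtains D :: "(nat \<Rightarrow> nat) set" and p where "finite_distribution D p"
    and "\<And>A. A \<subseteq> N4 \<Longrightarrow> h A = finite_distribution.ent D p (subvector (\<lambda>i g. g i) A)"
proof -
  obtain M :: "(nat \<Rightarrow> nat) measure" and X where M: "prob_space M"
    and X: "\<forall>i\<in>N4. simple_function M (X i)" and h: "\<And>A. A \<subseteq> N4 \<Longrightarrow> h A = joint_entropy M X A"
    using assms by (auto simp: entropic_def)
  interpret prob_space M by fact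
  define F where "F = subvector X N4"
  have F: "simple_function M F"
    unfolding F_def by (rule simple_function_subvector) (use X in \<open>auto simp: N4_def\<close>)
  define p where "p g = prob (F -` {g} \<inter> space M)" for g
  define S where "S = F ` space M"
  define D where "D = {g \<in> S. p g > 0}"
  have S: "finite S" and meas: "F -` {g} \<inter> space M \<in> events" for g
    using F by (auto simp: S_def simple_function_def intro: simple_functionD)
  \<comment> \<open>With \<open>P\<close> always true this gives the total weight, with
    \<open>P\<close> a fibre of a projection it gives the marginals.\<close>
  have prob_F: "prob {\<omega> \<in> space M. P (F \<omega>)} = (\<Sum>g | g \<in> S \<and> P g. p g)" for P
  proof -
    have "{\<omega> \<in> space M. P (F \<omega>)} = (\<Union>g\<in>{g \<in> S. P g}. F -` {g} \<inter> space M)"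
      by (auto simp: S_def)
    also have "prob \<dots> = (\<Sum>g | g \<in> S \<and> P g. p g)"
      unfolding p_def using S meas
      by (intro finite_measure_finite_Union) (auto simp: disjoint_family_on_def)
    finally show ?thesis .
  qed
  have p_D: "(\<Sum>g | g \<in> S \<and> P g. p g) = (\<Sum>g | g \<in> D \<and> P g. p g)" for P
    by (rule sum.mono_neutral_right) (use S in \<open>auto simp: D_def p_def less_le\<close>)
  have "finite_distribution D p"
  proof
    show "finite D" using S by (simp add: D_def)
    show "sum p D = 1" using prob_F[of "\<lambda>_. True"] p_D[of "\<lambda>_. True"] prob_space by simp
  qed (simp add: D_def)
  then interpret fd: finite_distribution D p .
  have "h A = fd.ent (subvector (\<lambda>i g. g i) A)" if A: "A \<subseteq> N4" for A
  proof -
    let ?r = "subvector (\<lambda>i g. g i) A"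
    have sub: "subvector X A = (\<lambda>\<omega>. ?r (F \<omega>))"
      using A by (auto simp: F_def subvector_def restrict_def fun_eq_iff)
    have img: "subvector X A ` space M = ?r ` S" by (auto simp: sub S_def)
    have mass: "prob (subvector X A -` {y} \<inter> space M) = fd.mass ?r y" for y
    proof -
      have "subvector X A -` {y} \<inter> space M = {\<omega> \<in> space M. ?r (F \<omega>) = y}" by (auto simp: sub)
      then show ?thesis using prob_F p_D by (simp add: fd.mass_def)
    qed
    have "simple_function M (subvector X A)"
      by (rule simple_function_subvector) (use X A in \<open>auto simp: N4_def intro: finite_subset\<close>)
    then have "h A = - (\<Sum>y\<in>?r ` S. fd.mass ?r y * log 2 (fd.mass ?r y))"
      unfolding h[OF A] joint_entropy_def
      by (subst entropy_simple_function[OF M]) (simp_all add: mass img)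
    \<comment> \<open>A value attained only at dropped vectors has mass 0, and its summand is 0
      because of the factor in front of the logarithm.\<close>
    also have "(\<Sum>y\<in>?r ` S. fd.mass ?r y * log 2 (fd.mass ?r y))
        = (\<Sum>y\<in>?r ` D. fd.mass ?r y * log 2 (fd.mass ?r y))"
    proof (rule sum.mono_neutral_right)
      show "\<forall>y\<in>?r ` S - ?r ` D. fd.mass ?r y * log 2 (fd.mass ?r y) = 0"
      proof
        fix y assume "y \<in> ?r ` S - ?r ` D"
        then have none: "{d \<in> D. ?r d = y} = {}" by blast
        show "fd.mass ?r y * log 2 (fd.mass ?r y) = 0" unfolding fd.mass_def none by simp
      qed
    qed (use S in \<open>auto simp: D_def\<close>)
    finally show ?thesis by (simp add: fd.ent_values)
  qed
  with \<open>finite_distribution D p\<close> show thesis by (rule that)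
qed

section \<open>Necessity\<close>

text \<open>The prescribed values encode the hypotheses of \<open>log_card_le_ent\<close>: the
  values at \<open>{1, 3}\<close> and \<open>{2, 3}\<close> are sums of those at the singletons
  (independence), and every pair has the value of the triple (each pair determines the third
  variable).\<close>

lemma entropic_imp_log_ceiling_le:
  assumes "entropic h"
    and singles: "h {1} = a + b" "h {2} = a + b" "h {3} = a"
    and sets: "h {1, 2} = 2 * a + b" "h {1, 3} = 2 * a + b" "h {2, 3} = 2 * a + b"
      "h {1, 2, 3} = 2 * a + b"
  shows "log 2 (of_int \<lceil>2 powr a\<rceil>) \<le> a + b"
proof -
  obtain D :: "(nat \<Rightarrow> nat) set" and p where "finite_distribution D p"
    and h: "\<And>A. A \<subseteq> N4 \<Longrightarrow> h A = finite_distribution.ent D p (subvector (\<lambda>i g. g i) A)"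
    using entropic_imp_finite_distribution[OF assms(1)] by blast
  interpret finite_distribution D p by fact
  have "h {1} = ent (\<lambda>g. g 1)" "h {2} = ent (\<lambda>g. g 2)" "h {3} = ent (\<lambda>g. g 3)"
    "h {1, 2} = ent (\<lambda>g. (g 1, g 2))" "h {1, 3} = ent (\<lambda>g. (g 1, g 3))"
    "h {2, 3} = ent (\<lambda>g. (g 2, g 3))" "h {1, 2, 3} = ent (\<lambda>g. (g 1, g 2, g 3))"
    by (rule trans[OF h], simp add: N4_def, rule ent_cong, simp add: subvector_eq_iff)+
  note ents = this[symmetric, unfolded singles sets]
  define m where "m = card ((\<lambda>g. g 3) ` D)"
  have m: "m > 0" using nonempty by (simp add: m_def card_gt_0_iff)
  have "a \<le> log 2 m" using ent_le_log_card[of "\<lambda>g. g 3"] by (simp add: ents m_def)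
  then have "2 powr a \<le> m" using m by (simp add: le_log_iff)
  then have "\<lceil>2 powr a\<rceil> \<le> int m" by (intro ceiling_le) simp
  then have le: "of_int \<lceil>2 powr a\<rceil> \<le> real m" by linarith
  have "0 < \<lceil>2 powr a\<rceil>" by simp
  then have "0 < real_of_int \<lceil>2 powr a\<rceil>" by (simp only: of_int_0_less_iff)
  with le m have "log 2 (of_int \<lceil>2 powr a\<rceil>) \<le> log 2 m"
    by (simp only: log_le_cancel_iff of_nat_0_less_iff one_less_numeral_iff semiring_norm)
  also have "\<dots> \<le> a + b"
    \<comment> \<open>The instances are for \<open>X\<close>, \<open>Z\<close>, \<open>Y\<close>, in
      the order in which these occur in the lemma.\<close>
    using log_card_le_ent[of "\<lambda>g. g 1" "\<lambda>g. g 3" "\<lambda>g. g 2"] by (simp add: ents m_def del: One_nat_def)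
  finally show ?thesis .
qed

section \<open>Construction\<close>

text \<open>The point 0 matters, since probabilities vanish at an end of the path in
  \<open>ex_finite_distribution_ent\<close>. There \<open>x * ln x\<close> tends to 0, which is also
  the value of the product.\<close>

lemma continuous_on_xlogx: "continuous_on {0..} (\<lambda>x::real. x * log 2 x)"
proof -
  have "continuous_on {0..} (\<lambda>x::real. x * ln x)"
    unfolding continuous_on_def
  proof
    fix x :: real assume "x \<in> {0..}"
    show "((\<lambda>x. x * ln x) \<longlongrightarrow> x * ln x) (at x within {0..})"
    proof (cases "x = 0")
      case True
      have "((\<lambda>x::real. x * ln x) \<longlongrightarrow> 0) (at_right 0)" by real_asymp
      then show ?thesis using True by (simp add: at_within_Ici_at_right)
    next
      case False
      then have "isCont (\<lambda>x. x * ln x) x" by (intro continuous_intros)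
      then show ?thesis using isCont_def tendsto_within_subset by blast
    qed
  qed
  then have "continuous_on {0..} (\<lambda>x::real. x * ln x / ln 2)"
    by (rule continuous_on_divide[OF _ continuous_on_const]) simp
  then show ?thesis by (simp add: log_def)
qed

text \<open>Intermediate value theorem along the segment from a point mass, of entropy 0, to the
  uniform distribution on \<open>n\<close> points, of entropy \<open>log 2 n\<close>.\<close>

lemma ex_finite_distribution_ent:
  assumes c: "0 \<le> c" "c \<le> log 2 (real n)" and n: "n > 0"
  obtains R :: "nat set" and r where "finite_distribution R r" "R \<subseteq> {..<n}"
    "finite_distribution.ent R r (\<lambda>i. i) = c"
proof -
  define \<eta> where "\<eta> x = - (x * log 2 x)" for x :: real
  \<comment> \<open>The mixture of the point mass at 0, with weight \<open>1 - s\<close>, and the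
    uniform distribution, with weight \<open>s\<close>.\<close>
  define w where "w s i = (if i = 0 then 1 - s * (1 - 1 / n) else s / n)" for s :: real and i :: nat
  define \<phi> where "\<phi> s = (\<Sum>i<n. \<eta> (w s i))" for s
  have nn: "w s i \<ge> 0" if "s \<in> {0..1}" for s i
  proof -
    have "s * (1 - 1 / n) \<le> 1 * 1" using that n by (intro mult_mono) auto
    then show ?thesis using that by (auto simp: w_def)
  qed
  have ends: "\<phi> 0 = 0" "\<phi> 1 = log 2 n"
  proof -
    show "\<phi> 0 = 0" by (auto simp: \<phi>_def w_def \<eta>_def intro!: sum.neutral)
    have "w 1 i = 1 / n" for i by (simp add: w_def)
    then show "\<phi> 1 = log 2 n" using n by (simp add: \<phi>_def \<eta>_def log_divide)
  qed
  have "continuous_on {0..1} \<phi>"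
  proof -
    have "continuous_on {0..1} (\<lambda>s. w s i * log 2 (w s i))" for i
    proof (rule continuous_on_compose2[OF continuous_on_xlogx])
      show "continuous_on {0..1} (\<lambda>s. w s i)"
        unfolding w_def using n by (cases "i = 0") (auto intro!: continuous_intros)
    qed (use nn in auto)
    then show ?thesis
      unfolding \<phi>_def \<eta>_def by (intro continuous_on_sum continuous_on_minus)
  qed
  then obtain s where s: "s \<in> {0..1}" "\<phi> s = c"
    using IVT'[of \<phi> 0 c 1] c by (auto simp: ends)
  \<comment> \<open>Some weights may vanish, for instance at \<open>s = 0\<close>. Restricting to
    the positive ones changes neither the total nor the entropy, since \<eta> vanishes at 0.\<close>
  define R where "R = {i. i < n \<and> w s i > 0}"
  have sum_R: "(\<Sum>i\<in>R. f i) = (\<Sum>i<n. f i)" if "\<And>i. w s i = 0 \<Longrightarrow> f i = 0" for f :: "nat \<Rightarrow> real"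
  proof (rule sum.mono_neutral_left)
    show "\<forall>i\<in>{..<n} - R. f i = 0"
    proof
      fix i assume "i \<in> {..<n} - R"
      then have "w s i = 0" using nn[OF s(1), of i] by (simp add: R_def)
      then show "f i = 0" by (rule that)
    qed
  qed (auto simp: R_def)
  have fd: "finite_distribution R (w s)"
  proof
    obtain k where k: "n = Suc k" using n gr0_conv_Suc by blast
    have "(\<Sum>i<n. w s i) = 1"
    proof -
      have "(\<Sum>i<n. w s i) = w s 0 + (\<Sum>i<k. w s (Suc i))"
        unfolding k by (rule sum.lessThan_Suc_shift)
      also have "\<dots> = 1 - s * (1 - 1 / n) + (real n - 1) * (s / n)"
        by (simp add: w_def) (simp add: k)
      also have "\<dots> = 1" using n by (simp add: field_simps)
      finally show ?thesis .
    qed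
    then show "sum (w s) R = 1" using sum_R[of "w s"] by simp
  qed (auto simp: R_def)
  interpret finite_distribution R "w s" by (rule fd)
  have "ent (\<lambda>i. i) = (\<Sum>i\<in>R. \<eta> (w s i))"
    by (simp add: ent_ident \<eta>_def flip: sum_negf)
  also have "\<dots> = c" using s(2) by (subst sum_R) (simp_all add: \<eta>_def \<phi>_def)
  finally have "ent (\<lambda>i. i) = c" .
  with fd show thesis by (intro that) (auto simp: R_def)
qed

text \<open>The unique solution is \<open>v - z\<close> modulo \<open>m\<close>, written with
  \<open>m - z\<close> because subtraction of naturals truncates. Both sums stay below
  \<open>2 * m\<close>, so reduction subtracts \<open>m\<close> at most once.\<close>

lemma add_mod_eq_iff:
  fixes u v z m :: nat
  assumes "v < m" "z < m"
  shows "u < m \<and> (u + z) mod m = v \<longleftrightarrow> u = (v + (m - z)) mod m"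
proof -
  have wrap: "x mod m = (if x < m then x else x - m)" if "x < 2 * m" for x
    using that by (simp add: le_mod_geq)
  have "u < m \<Longrightarrow> (u + z) mod m = (if u + z < m then u + z else u + z - m)"
    using assms by (intro wrap) simp
  moreover have "(v + (m - z)) mod m = (if v + (m - z) < m then v + (m - z) else v + (m - z) - m)"
    using assms by (intro wrap) simp
  ultimately show ?thesis using assms by (auto split: if_splits)
qed

lemma sum_triple:
  fixes f :: "'a \<Rightarrow> real" and g :: "'b \<Rightarrow> real" and h :: "'c \<Rightarrow> real"
  shows "(\<Sum>(u, w, z)\<in>U \<times> W \<times> R. f u * g w * h z) = sum f U * sum g W * sum h R"
proof -
  have "(\<Sum>(u, w, z)\<in>U \<times> W \<times> R. f u * g w * h z)
      = (\<Sum>u\<in>U. \<Sum>y\<in>W \<times> R. f u * (g (fst y) * h (snd y)))"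
    by (simp add: sum.cartesian_product case_prod_unfold mult.assoc)
  also have "\<dots> = sum f U * (\<Sum>y\<in>W \<times> R. g (fst y) * h (snd y))"
    by (simp only: sum_distrib_left[symmetric] sum_distrib_right[symmetric])
  also have "(\<Sum>y\<in>W \<times> R. g (fst y) * h (snd y)) = sum g W * sum h R"
    by (simp add: sum_product sum.cartesian_product case_prod_unfold)
  finally show ?thesis by (simp add: mult.assoc)
qed

text \<open>Any two of \<open>u\<close>, \<open>u + z\<close> and \<open>z\<close> modulo
  \<open>m\<close> determine the third, and \<open>w\<close> is part of both \<open>X\<close> and
  \<open>Y\<close>, so any two of the three variables recover the outcome. Both \<open>X\<close> and
  \<open>Y\<close> give their values mass \<open>q w / m\<close>, hence entropy
  \<open>log 2 m + c\<close>.\<close>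

lemma ex_finite_distribution_quasigroup:
  fixes m :: nat
  assumes a: "0 \<le> a" "a \<le> log 2 m" and b: "log 2 m \<le> a + b" and m: "m > 0"
  obtains D :: "(nat \<times> nat \<times> nat) set" and p and X Y Z :: "nat \<times> nat \<times> nat \<Rightarrow> nat"
  where "finite_distribution D p"
    and "finite_distribution.ent D p X = a + b" "finite_distribution.ent D p Y = a + b"
      "finite_distribution.ent D p Z = a" "finite_distribution.ent D p (\<lambda>d. d) = 2 * a + b"
    and "\<And>d d'. d \<in> D \<Longrightarrow> d' \<in> D \<Longrightarrow> X d = X d' \<and> Y d = Y d' \<longleftrightarrow> d = d'"
      "\<And>d d'. d \<in> D \<Longrightarrow> d' \<in> D \<Longrightarrow> X d = X d' \<and> Z d = Z d' \<longleftrightarrow> d = d'"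
      "\<And>d d'. d \<in> D \<Longrightarrow> d' \<in> D \<Longrightarrow> Y d = Y d' \<and> Z d = Z d' \<longleftrightarrow> d = d'"
proof -
  obtain R :: "nat set" and r where R: "finite_distribution R r" "R \<subseteq> {..<m}"
      "finite_distribution.ent R r (\<lambda>i. i) = a"
    using ex_finite_distribution_ent[OF a m] .
  \<comment> \<open>The entropy that \<open>X\<close> still lacks after the uniform coordinate has
    contributed \<open>log 2 m\<close>; the coordinate \<open>w\<close> supplies it.\<close>
  define c where "c = a + b - log 2 m"
  have c: "0 \<le> c" using b by (simp add: c_def)
  \<comment> \<open>An alphabet size large enough for entropy \<open>c\<close>.\<close>
  define n where "n = nat \<lceil>2 powr c\<rceil>"
  have n: "2 powr c \<le> real n" "n > 0"
    unfolding n_def by (simp_all add: real_nat_ceiling_ge)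
  then have "c \<le> log 2 n" by (simp add: le_log_iff)
  with c obtain W :: "nat set" and q where W: "finite_distribution W q"
      "finite_distribution.ent W q (\<lambda>i. i) = c"
    using ex_finite_distribution_ent[OF _ _ n(2)] by metis
  interpret R: finite_distribution R r by (rule R)
  interpret W: finite_distribution W q by (rule W)
  define D where "D = {..<m} \<times> W \<times> R"
  define p where "p = (\<lambda>(u :: nat, w, z). 1 / m * q w * r z)"
  have sum_D: "(\<Sum>(u, w, z)\<in>D. f u * g w * h z) = sum f {..<m} * sum g W * sum h R"
    for f g h :: "nat \<Rightarrow> real"
    unfolding D_def by (rule sum_triple)
  have "finite_distribution D p"
  proof
    show "sum p D = 1"
      using sum_D[of "\<lambda>_. 1 / m" q r] m by (simp add: p_def W.sum_weights R.sum_weights)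
  qed (use m in \<open>auto simp: D_def p_def W.weight_pos R.weight_pos\<close>)
  then interpret finite_distribution D p .
  \<comment> \<open>\<open>prod_encode\<close> packs the pair into one natural number, as the
    alphabets consist of naturals.\<close>
  define X where "X = (\<lambda>(u :: nat, w :: nat, z :: nat). prod_encode (u, w))"
  define Y where "Y = (\<lambda>(u, w, z). prod_encode ((u + z) mod m, w))"
  define Z where "Z = (\<lambda>(u :: nat, w :: nat, z :: nat). z)"
  have q: "q w > 0" if "w \<in> W" for w using W.weight_pos that .
  have r: "r z > 0" if "z \<in> R" for z using R.weight_pos that .
  have Hq: "(\<Sum>w\<in>W. q w * log 2 (q w)) = - c" and Hr: "(\<Sum>z\<in>R. r z * log 2 (r z)) = - a"
    using W(2) R(3) by (simp_all add: W.ent_ident R.ent_ident)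
  \<comment> \<open>The logarithms of \<open>p\<close> and of the masses of \<open>X\<close>,
    \<open>Y\<close>, \<open>Z\<close> are all combinations of \<open>L\<close>, \<open>K\<close>
    and \<open>log 2 m\<close>, so three averages yield all four entropies.\<close>
  define L where "L = (\<lambda>(u :: nat, w, z :: nat). log 2 (q w))"
  define K where "K = (\<lambda>(u :: nat, w :: nat, z). log 2 (r z))"
  have sum_L: "(\<Sum>d\<in>D. p d * L d) = - c"
    using sum_D[of "\<lambda>_. 1 / m" "\<lambda>w. q w * log 2 (q w)" r] m
    by (simp add: p_def L_def case_prod_unfold R.sum_weights Hq mult_ac)
  have sum_K: "(\<Sum>d\<in>D. p d * K d) = - a"
    using sum_D[of "\<lambda>_. 1 / m" q "\<lambda>z. r z * log 2 (r z)"] m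
    by (simp add: p_def K_def case_prod_unfold W.sum_weights Hr mult_ac)
  have sum_m: "(\<Sum>d\<in>D. p d * log 2 m) = log 2 m"
    by (simp add: sum_weights flip: sum_distrib_right)
  have mX: "mass X (X (u, w, z)) = 1 / m * q w" if "(u, w, z) \<in> D" for u w z
  proof -
    have "{d \<in> D. X d = X (u, w, z)} = (\<lambda>z'. (u, w, z')) ` R"
      using that by (auto simp: X_def D_def)
    then have "mass X (X (u, w, z)) = (\<Sum>z'\<in>R. p (u, w, z'))"
      by (simp add: mass_def sum.reindex inj_on_def)
    then show ?thesis by (simp add: p_def R.sum_weights flip: sum_distrib_left sum_divide_distrib)
  qed
  have mY: "mass Y (Y (u, w, z)) = 1 / m * q w" if "(u, w, z) \<in> D" for u w z
  proof -
    \<comment> \<open>For each \<open>z'\<close> exactly one \<open>u'\<close> gives the prescribed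
      sum. The fibre of \<open>Y\<close> is thus a graph over \<open>R\<close>, and summing
      \<open>r\<close> over it leaves \<open>q w / m\<close>.\<close>
    have shift: "u' < m \<and> (u' + z') mod m = (u + z) mod m
        \<longleftrightarrow> u' = ((u + z) mod m + (m - z')) mod m" if "z' \<in> R" for u' z'
      using that R(2) m by (intro add_mod_eq_iff) auto
    have "d \<in> D \<and> Y d = Y (u, w, z)
        \<longleftrightarrow> d \<in> (\<lambda>z'. (((u + z) mod m + (m - z')) mod m, w, z')) ` R" for d
    proof (cases d)
      case (fields u' w' z')
      have "d \<in> D \<and> Y d = Y (u, w, z)
          \<longleftrightarrow> z' \<in> R \<and> w' = w \<and> u' < m \<and> (u' + z') mod m = (u + z) mod m"
        using that by (auto simp: fields Y_def D_def)
      also have "\<dots> \<longleftrightarrow> z' \<in> R \<and> w' = w \<and> u' = ((u + z) mod m + (m - z')) mod m"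
        using shift by blast
      finally show ?thesis by (auto simp: fields)
    qed
    then have "{d \<in> D. Y d = Y (u, w, z)}
        = (\<lambda>z'. (((u + z) mod m + (m - z')) mod m, w, z')) ` R"
      by blast
    then have "mass Y (Y (u, w, z)) = (\<Sum>z'\<in>R. p (((u + z) mod m + (m - z')) mod m, w, z'))"
      by (simp add: mass_def sum.reindex inj_on_def)
    then show ?thesis by (simp add: p_def R.sum_weights flip: sum_distrib_left sum_divide_distrib)
  qed
  have mZ: "mass Z (Z (u, w, z)) = r z" if "(u, w, z) \<in> D" for u w z
  proof -
    have "{d \<in> D. Z d = Z (u, w, z)} = {..<m} \<times> W \<times> {z}"
      using that by (auto simp: Z_def D_def)
    then have "mass Z (Z (u, w, z)) = (\<Sum>(u, w, z)\<in>{..<m} \<times> W \<times> {z}. 1 / m * q w * r z)"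
      unfolding mass_def unfolding p_def by simp
    also have "\<dots> = r z" by (subst sum_triple) (use m in \<open>simp add: W.sum_weights\<close>)
    finally show ?thesis .
  qed
  have logX: "log 2 (mass X (X d)) = L d - log 2 m"
    and logY: "log 2 (mass Y (Y d)) = L d - log 2 m"
    and logZ: "log 2 (mass Z (Z d)) = K d"
    and logp: "log 2 (p d) = L d + K d - log 2 m"
    if D: "d \<in> D" for d
  proof -
    obtain u w z where d: "d = (u, w, z)" by (cases d)
    have pos: "q w > 0" "r z > 0" using D q r by (auto simp: D_def d)
    show "log 2 (mass X (X d)) = L d - log 2 m" "log 2 (mass Y (Y d)) = L d - log 2 m"
      using mX mY D pos m unfolding d by (simp_all add: L_def log_divide)
    show "log 2 (mass Z (Z d)) = K d" "log 2 (p d) = L d + K d - log 2 m"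
      using mZ D pos m unfolding d by (simp_all add: p_def L_def K_def log_mult log_divide)
  qed
  have ents: "ent X = a + b" "ent Y = a + b" "ent Z = a"
    using sum_L sum_K sum_m
    by (simp_all add: ent_def logX logY logZ right_diff_distrib sum_subtractf c_def)
  have ent_D: "ent (\<lambda>d. d) = 2 * a + b"
    using sum_L sum_K sum_m
    by (simp add: ent_ident logp right_diff_distrib distrib_left sum_subtractf sum.distrib c_def)
  have det: "X d = X d' \<and> Y d = Y d' \<longleftrightarrow> d = d'" "X d = X d' \<and> Z d = Z d' \<longleftrightarrow> d = d'"
    "Y d = Y d' \<and> Z d = Z d' \<longleftrightarrow> d = d'" if "d \<in> D" "d' \<in> D" for d d'
  proof -
    obtain u w z where d: "d = (u, w, z)" by (cases d)
    obtain u' w' z' where d': "d' = (u', w', z')" by (cases d')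
    have lt: "u < m" "u' < m" "z < m" "z' < m" using that R(2) by (auto simp: d d' D_def)
    \<comment> \<open>Cancellation: both residues solve the same congruence and so equal the one
      solution given by \<open>add_mod_eq_iff\<close>.\<close>
    have "z = z'" if "(u + z) mod m = (u + z') mod m"
      using add_mod_eq_iff[of "(u + z') mod m" m u z] add_mod_eq_iff[of "(u + z') mod m" m u z'] that lt m
      by (simp add: add.commute)
    moreover have "u = u'" if "(u + z) mod m = (u' + z) mod m"
      using add_mod_eq_iff[of "(u' + z) mod m" m z u] add_mod_eq_iff[of "(u' + z) mod m" m z u'] that lt m
      by simp
    ultimately show "X d = X d' \<and> Y d = Y d' \<longleftrightarrow> d = d'" "X d = X d' \<and> Z d = Z d' \<longleftrightarrow> d = d'"
      "Y d = Y d' \<and> Z d = Z d' \<longleftrightarrow> d = d'"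
      by (auto simp: X_def Y_def Z_def d d')
  qed
  show thesis by (rule that[OF \<open>finite_distribution D p\<close> ents ent_D det])
qed

lemma entropic_face_points:
  assumes "a \<ge> 0" and "log 2 (of_int \<lceil>2 powr a\<rceil>) \<le> a + b"
  shows "entropic (face_point (uniform_rank 2 {1, 2, 3}) (uniform_rank 1 {1, 2}) a b)"
    and "entropic (face_point (W2_rank {3, 4}) (uniform_rank 1 {1, 2}) a b)"
    and "entropic (face_point (W2_rank {1, 4}) (uniform_rank 1 {1, 2, 4}) a b)"
proof -
  \<comment> \<open>The least alphabet size that admits entropy \<open>a\<close>; the second
    assumption then reads \<open>log 2 m <= a + b\<close>.\<close>
  define m where "m = nat \<lceil>2 powr a\<rceil>"
  have m: "2 powr a \<le> real m" "m > 0" unfolding m_def by (simp_all add: real_nat_ceiling_ge)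
  then have am: "a \<le> log 2 m" by (simp add: le_log_iff)
  have mb: "log 2 m \<le> a + b" using assms(2) by (simp add: m_def)
  obtain D :: "(nat \<times> nat \<times> nat) set" and p and X Y Z :: "nat \<times> nat \<times> nat \<Rightarrow> nat"
    where "finite_distribution D p"
    and ents: "finite_distribution.ent D p X = a + b" "finite_distribution.ent D p Y = a + b"
      "finite_distribution.ent D p Z = a" "finite_distribution.ent D p (\<lambda>d. d) = 2 * a + b"
    and det: "\<And>d d'. d \<in> D \<Longrightarrow> d' \<in> D \<Longrightarrow> X d = X d' \<and> Y d = Y d' \<longleftrightarrow> d = d'"
      "\<And>d d'. d \<in> D \<Longrightarrow> d' \<in> D \<Longrightarrow> X d = X d' \<and> Z d = Z d' \<longleftrightarrow> d = d'"
      "\<And>d d'. d \<in> D \<Longrightarrow> d' \<in> D \<Longrightarrow> Y d = Y d' \<and> Z d = Z d' \<longleftrightarrow> d = d'"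
    by (rule ex_finite_distribution_quasigroup[OF assms(1) am mb m(2)]) (rule that)
  interpret finite_distribution D p by fact
  \<comment> \<open>\<open>T\<close> is the choice of \<open>X\<^sub>4\<close>, which is all that differs between the three faces.\<close>
  define V where "V T i = (if i = 1 then X else if i = 2 then Y else if i = 3 then Z else T)"
    for T and i :: nat
  have V: "V T 1 = X" "V T (Suc 0) = X" "V T 2 = Y" "V T 3 = Z" "V T 4 = T" for T
    by (simp_all add: V_def)
  note rank = face_point_def uniform_rank_def W2_rank_alt
    and kernel = subvector_eq_iff V
  \<comment> \<open>For each of the sixteen sets \<open>A\<close> the subvector has the same fibres
    as a constant, \<open>X\<close>, \<open>Y\<close>, \<open>Z\<close> or the identity. The next
    five facts reduce its entropy to matching the rank value \<open>t\<close> and the fibres;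
    \<open>t\<close> alone cannot tell \<open>X\<close> from \<open>Y\<close>, the fibres
    do.\<close>
  have const: "ent f = t" if "t = 0" "\<And>d d'. d \<in> D \<Longrightarrow> d' \<in> D \<Longrightarrow> f d = f d'" for f t
  proof -
    have "ent f = ent (\<lambda>_. ())" using that(2) by (intro ent_cong) blast
    then show ?thesis using that(1) by (simp add: ent_const)
  qed
  have likeX: "ent f = t"
    if "t = a + b" "\<And>d d'. d \<in> D \<Longrightarrow> d' \<in> D \<Longrightarrow> f d = f d' \<longleftrightarrow> X d = X d'" for f t
    unfolding that(1) ents(1)[symmetric] using that(2) by (rule ent_cong)
  have likeY: "ent f = t"
    if "t = a + b" "\<And>d d'. d \<in> D \<Longrightarrow> d' \<in> D \<Longrightarrow> f d = f d' \<longleftrightarrow> Y d = Y d'" for f t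
    unfolding that(1) ents(2)[symmetric] using that(2) by (rule ent_cong)
  have likeZ: "ent f = t"
    if "t = a" "\<And>d d'. d \<in> D \<Longrightarrow> d' \<in> D \<Longrightarrow> f d = f d' \<longleftrightarrow> Z d = Z d'" for f t
    unfolding that(1) ents(3)[symmetric] using that(2) by (rule ent_cong)
  have inj: "ent f = t"
    if "t = 2 * a + b" "\<And>d d'. d \<in> D \<Longrightarrow> d' \<in> D \<Longrightarrow> f d = f d' \<longleftrightarrow> d = d'" for f t
    unfolding that(1) ents(4)[symmetric] using that(2) by (rule ent_cong)
  show "entropic (face_point (uniform_rank 2 {1, 2, 3}) (uniform_rank 1 {1, 2}) a b)"
  proof (rule entropic_ent)
    fix A assume "A \<subseteq> N4"
    then have "ent (subvector (V (\<lambda>_. 0)) A)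
        = face_point (uniform_rank 2 {1, 2, 3}) (uniform_rank 1 {1, 2}) a b A"
      by (cases rule: subset_N4_cases)
        (simp only:, (rule const, (simp add: rank; fail), (simp add: kernel; fail)
          | rule likeX, (simp add: rank; fail), (simp add: kernel; fail)
          | rule likeY, (simp add: rank; fail), (simp add: kernel; fail)
          | rule likeZ, (simp add: rank; fail), (simp add: kernel; fail)
          | rule inj, (simp add: rank; fail), simp add: kernel, metis det))+
    then show "face_point (uniform_rank 2 {1, 2, 3}) (uniform_rank 1 {1, 2}) a b A
        = ent (subvector (V (\<lambda>_. 0)) A)" ..
  qed
  show "entropic (face_point (W2_rank {3, 4}) (uniform_rank 1 {1, 2}) a b)"
  proof (rule entropic_ent)
    fix A assume "A \<subseteq> N4"
    then have "ent (subvector (V Z) A) = face_point (W2_rank {3, 4}) (uniform_rank 1 {1, 2}) a b A"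
      by (cases rule: subset_N4_cases)
        (simp only:, (rule const, (simp add: rank; fail), (simp add: kernel; fail)
          | rule likeX, (simp add: rank; fail), (simp add: kernel; fail)
          | rule likeY, (simp add: rank; fail), (simp add: kernel; fail)
          | rule likeZ, (simp add: rank; fail), (simp add: kernel; fail)
          | rule inj, (simp add: rank; fail), simp add: kernel, metis det))+
    then show "face_point (W2_rank {3, 4}) (uniform_rank 1 {1, 2}) a b A
        = ent (subvector (V Z) A)" ..
  qed
  show "entropic (face_point (W2_rank {1, 4}) (uniform_rank 1 {1, 2, 4}) a b)"
  proof (rule entropic_ent)
    fix A assume "A \<subseteq> N4"
    then have "ent (subvector (V X) A) = face_point (W2_rank {1, 4}) (uniform_rank 1 {1, 2, 4}) a b A"
      by (cases rule: subset_N4_cases)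
        (simp only:, (rule const, (simp add: rank; fail), (simp add: kernel; fail)
          | rule likeX, (simp add: rank; fail), (simp add: kernel; fail)
          | rule likeY, (simp add: rank; fail), (simp add: kernel; fail)
          | rule likeZ, (simp add: rank; fail), (simp add: kernel; fail)
          | rule inj, (simp add: rank; fail), simp add: kernel, metis det))+
    then show "face_point (W2_rank {1, 4}) (uniform_rank 1 {1, 2, 4}) a b A
        = ent (subvector (V X) A)" ..
  qed
qed

text \<open>The three faces agree on the nonempty subsets of \<open>{1, 2, 3}\<close> and differ
  only in the role of 4, so a single necessity argument serves all of them.\<close>

lemma face_values:
  assumes "(r\<^sub>1, r\<^sub>2) \<in> {(uniform_rank 2 {1, 2, 3}, uniform_rank 1 {1, 2}),
                        (W2_rank {3, 4}, uniform_rank 1 {1, 2}),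
                        (W2_rank {1, 4}, uniform_rank 1 {1, 2, 4})}"
  shows "face_point r\<^sub>1 r\<^sub>2 a b {1} = a + b" "face_point r\<^sub>1 r\<^sub>2 a b {2} = a + b"
    "face_point r\<^sub>1 r\<^sub>2 a b {3} = a" "face_point r\<^sub>1 r\<^sub>2 a b {1, 2} = 2 * a + b"
    "face_point r\<^sub>1 r\<^sub>2 a b {1, 3} = 2 * a + b" "face_point r\<^sub>1 r\<^sub>2 a b {2, 3} = 2 * a + b"
    "face_point r\<^sub>1 r\<^sub>2 a b {1, 2, 3} = 2 * a + b"
  using assms by (auto simp: face_point_def uniform_rank_def W2_rank_alt)

theorem mainTheorem4:
  fixes r\<^sub>1 r\<^sub>2 :: "nat set \<Rightarrow> real" and a b :: real
  assumes "(r\<^sub>1, r\<^sub>2) \<in> {(uniform_rank 2 {1, 2, 3}, uniform_rank 1 {1, 2}),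
                        (W2_rank {3, 4}, uniform_rank 1 {1, 2}),
                        (W2_rank {1, 4}, uniform_rank 1 {1, 2, 4})}"
    and "a \<ge> 0" and "b \<ge> 0"
  shows "entropic (face_point r\<^sub>1 r\<^sub>2 a b) \<longleftrightarrow> a + b \<ge> log 2 (of_int \<lceil>2 powr a\<rceil>)"
proof
  assume "entropic (face_point r\<^sub>1 r\<^sub>2 a b)"
  then show "a + b \<ge> log 2 (of_int \<lceil>2 powr a\<rceil>)"
    by (rule entropic_imp_log_ceiling_le) (rule face_values[OF assms(1)])+
next
  assume "a + b \<ge> log 2 (of_int \<lceil>2 powr a\<rceil>)"
  from entropic_face_points[OF assms(2) this] assms(1)
  show "entropic (face_point r\<^sub>1 r\<^sub>2 a b)" by auto
qed

end
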